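(* Let $K$ be a subcomplex of a finite simplicial complex $L$, let $k\ge 0$, and let $\beta$ be a $k$-cocycle on $K$ whose class $[\beta]_K\in \mathrm{H}^k(K)$ dies between $K$ and $L$. Then a cochain $\hat\beta\in \mathrm{C}^k(L)$ is a death potential for $\beta$ if and only if $$\hat{\beta}|_K=\beta \qquad\text{and}\qquad (\Delta^{k,\mathrm{up}}_L \hat{\beta})\big|_{L\setminus K}=0.$$
   Context: All simplicial complexes are finite and all (co)homology has real coefficients. $\mathrm{C}^k(X)$ is the space of real-valued functions on the set of $k$-simplices of $X$ (with orientations fixed), with inner product $\langle\alpha,\beta\rangle=\sum_\sigma \alpha(\sigma)\beta(\sigma)$ and norm $\|\cdot\|_2$; $\delta_X^k:\mathrm{C}^k(X)\to \mathrm{C}^{k+1}(X)$ is the coboundary operator and $(\delta_X^k)^*$ its adjoint. For $\varphi\in \mathrm{C}^k(L)$, $\varphi|_K$ is its restriction to the $k$-simplices of $K$, and $\varphi|_{L\setminus K}$ its restriction to the $k$-simplices of $L$ not in $K$. The $k$-th up Laplacian on $L$ is $\Delta_L^{k,\mathrm{up}}=(\delta_L^k)^*\delta_L^k:\mathrm{C}^k(L)\to \mathrm{C}^k(L)$. A class $[\beta]_K\in \mathrm{H}^k(K)$ dies between $K$ and $L$ if $\beta$ cannot be extended to a $k$-cocycle on $L$. A death potential for $\beta$ is any element of $\operatorname{arg\,min}_{\beta'\in \mathrm{C}^k(L)}\{\|\delta_L^k\beta'\|_2 : \beta'|_K=\beta\}$. *)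

theory Defs
  imports "HOL-Analysis.Analysis" "HOL-Combinatorics.Permutations"
begin

section \<open>Finite simplicial complexes\<close>

definition finite_simplicial_complex :: "'v set set \<Rightarrow> bool" where
  "finite_simplicial_complex X \<longleftrightarrow> finite X \<and>
     (\<forall>\<sigma>\<in>X. finite \<sigma> \<and> \<sigma> \<noteq> {}) \<and>
     (\<forall>\<sigma>\<in>X. \<forall>\<tau>. \<tau> \<subseteq> \<sigma> \<longrightarrow> \<tau> \<noteq> {} \<longrightarrow> \<tau> \<in> X)"

definition subcomplex :: "'v set set \<Rightarrow> 'v set set \<Rightarrow> bool" where
  "subcomplex K L \<longleftrightarrow>
     finite_simplicial_complex K \<and> finite_simplicial_complex L \<and> K \<subseteq> L"

definition simplices :: "nat \<Rightarrow> 'v set set \<Rightarrow> 'v set set" where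
  "simplices k X = {\<sigma>\<in>X. card \<sigma> = k + 1}"


section \<open>Orientations\<close>

text \<open>An orientation of a simplex is represented by an enumeration of its vertices; two
  enumerations that differ by an even permutation represent the same orientation and give the
  same coboundary operator. The enumerations need not come from a common order on the vertices.\<close>

definition orientation_on :: "'v set set \<Rightarrow> ('v set \<Rightarrow> 'v list) \<Rightarrow> bool" where
  "orientation_on X ori \<longleftrightarrow> (\<forall>\<sigma>\<in>X. distinct (ori \<sigma>) \<and> set (ori \<sigma>) = \<sigma>)"

definition relative_sign :: "'v list \<Rightarrow> 'v list \<Rightarrow> real" where
  "relative_sign xs ys = of_int (sign (THE p. p permutes set xs \<and> map p xs = ys))"


section \<open>Cochains\<close>

text \<open>Real functions on the \<open>k\<close>-simplices are represented by their extensions by zero. Hence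
  restrictions are also extended by zero.\<close>

definition cochains :: "nat \<Rightarrow> 'v set set \<Rightarrow> ('v set \<Rightarrow> real) set" where
  "cochains k X = {\<phi>. \<forall>\<sigma>. \<sigma> \<notin> simplices k X \<longrightarrow> \<phi> \<sigma> = 0}"

definition cochain_restrict :: "'v set set \<Rightarrow> ('v set \<Rightarrow> real) \<Rightarrow> ('v set \<Rightarrow> real)" where
  "cochain_restrict S \<phi> = (\<lambda>\<sigma>. if \<sigma> \<in> S then \<phi> \<sigma> else 0)"

definition cochain_inner ::
    "nat \<Rightarrow> 'v set set \<Rightarrow> ('v set \<Rightarrow> real) \<Rightarrow> ('v set \<Rightarrow> real) \<Rightarrow> real" where
  "cochain_inner k X \<alpha> \<beta> = (\<Sum>\<sigma>\<in>simplices k X. \<alpha> \<sigma> * \<beta> \<sigma>)"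

definition cochain_norm :: "nat \<Rightarrow> 'v set set \<Rightarrow> ('v set \<Rightarrow> real) \<Rightarrow> real" where
  "cochain_norm k X \<alpha> = sqrt (cochain_inner k X \<alpha> \<alpha>)"

text \<open>The value of \<open>\<phi>\<close> on the oriented simplex \<open>[x\<^sub>0, \<dots>, x\<^sub>k]\<close>: \<open>\<phi>\<close> records the value on the chosen
  orientation, and the value on the opposite orientation is its negative.\<close>

definition cochain_eval ::
    "('v set \<Rightarrow> 'v list) \<Rightarrow> ('v set \<Rightarrow> real) \<Rightarrow> 'v list \<Rightarrow> real" where
  "cochain_eval ori \<phi> xs = relative_sign xs (ori (set xs)) * \<phi> (set xs)"

text \<open>\<open>(\<delta>\<phi>)[x\<^sub>0, \<dots>, x\<^bsub>k+1\<^esub>] = (\<Sum>i\<le>k+1. (-1)\<^sup>i \<phi>[x\<^sub>0, \<dots>, x\<^bsub>i-1\<^esub>, x\<^bsub>i+1\<^esub>, \<dots>, x\<^bsub>k+1\<^esub>])\<close> on the chosen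
  orientation of each \<open>(k+1)\<close>-simplex.\<close>

definition coboundary ::
    "('v set \<Rightarrow> 'v list) \<Rightarrow> nat \<Rightarrow> 'v set set \<Rightarrow> ('v set \<Rightarrow> real) \<Rightarrow> ('v set \<Rightarrow> real)" where
  "coboundary ori k X \<phi> = (\<lambda>\<tau>. if \<tau> \<in> simplices (k + 1) X
     then \<Sum>i\<le>k + 1. (-1) ^ i * cochain_eval ori \<phi> (take i (ori \<tau>) @ drop (Suc i) (ori \<tau>))
     else 0)"

definition coboundary_adjoint ::
    "('v set \<Rightarrow> 'v list) \<Rightarrow> nat \<Rightarrow> 'v set set \<Rightarrow> ('v set \<Rightarrow> real) \<Rightarrow> ('v set \<Rightarrow> real)" where
  "coboundary_adjoint ori k X \<psi> = (THE \<alpha>. \<alpha> \<in> cochains k X \<and>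
     (\<forall>\<phi>\<in>cochains k X.
        cochain_inner (k + 1) X (coboundary ori k X \<phi>) \<psi> = cochain_inner k X \<phi> \<alpha>))"

definition up_laplacian ::
    "('v set \<Rightarrow> 'v list) \<Rightarrow> nat \<Rightarrow> 'v set set \<Rightarrow> ('v set \<Rightarrow> real) \<Rightarrow> ('v set \<Rightarrow> real)" where
  "up_laplacian ori k X \<phi> = coboundary_adjoint ori k X (coboundary ori k X \<phi>)"


section \<open>Cohomology and death\<close>

definition cocycles ::
    "('v set \<Rightarrow> 'v list) \<Rightarrow> nat \<Rightarrow> 'v set set \<Rightarrow> ('v set \<Rightarrow> real) set" where
  "cocycles ori k X = {\<phi> \<in> cochains k X. coboundary ori k X \<phi> = (\<lambda>_. 0)}"

text \<open>The cohomology is unreduced: the only \<open>0\<close>-coboundary is zero.\<close>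

fun coboundaries ::
    "('v set \<Rightarrow> 'v list) \<Rightarrow> nat \<Rightarrow> 'v set set \<Rightarrow> ('v set \<Rightarrow> real) set" where
  "coboundaries ori 0 X = {\<lambda>_. 0}"
| "coboundaries ori (Suc k) X = coboundary ori k X ` cochains k X"

definition cohomology_class ::
    "('v set \<Rightarrow> 'v list) \<Rightarrow> nat \<Rightarrow> 'v set set \<Rightarrow> ('v set \<Rightarrow> real) \<Rightarrow> ('v set \<Rightarrow> real) set" where
  "cohomology_class ori k X \<beta> = {\<lambda>\<sigma>. \<beta> \<sigma> + \<gamma> \<sigma> |\<gamma>. \<gamma> \<in> coboundaries ori k X}"

text \<open>Whether a cocycle on \<open>K\<close> extends to a cocycle on \<open>L\<close> depends only on its cohomology class,
  because coboundaries on \<open>K\<close> extend to coboundaries on \<open>L\<close>.\<close>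

definition dies_between ::
    "('v set \<Rightarrow> 'v list) \<Rightarrow> nat \<Rightarrow> 'v set set \<Rightarrow> 'v set set \<Rightarrow> ('v set \<Rightarrow> real) set \<Rightarrow> bool" where
  "dies_between ori k K L c \<longleftrightarrow>
     (\<exists>\<beta>\<in>cocycles ori k K. c = cohomology_class ori k K \<beta> \<and>
        \<not> (\<exists>\<beta>'\<in>cocycles ori k L. cochain_restrict (simplices k K) \<beta>' = \<beta>))"

definition death_potential ::
    "('v set \<Rightarrow> 'v list) \<Rightarrow> nat \<Rightarrow> 'v set set \<Rightarrow> 'v set set \<Rightarrow> ('v set \<Rightarrow> real) \<Rightarrow>
     ('v set \<Rightarrow> real) \<Rightarrow> bool" where
  "death_potential ori k K L \<beta> \<beta>hat \<longleftrightarrow>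
     is_arg_min (\<lambda>\<beta>'. cochain_norm (k + 1) L (coboundary ori k L \<beta>'))
       (\<lambda>\<beta>'. \<beta>' \<in> cochains k L \<and> cochain_restrict (simplices k K) \<beta>' = \<beta>) \<beta>hat"


section \<open>The adjoint is well defined\<close>

lemma finite_simplices [simp]: "finite X \<Longrightarrow> finite (simplices k X)"
  by (simp add: simplices_def)

lemma cochain_eval_sum:
  "cochain_eval ori (\<lambda>\<sigma>. \<Sum>s\<in>S. c s * f s \<sigma>) xs = (\<Sum>s\<in>S. c s * cochain_eval ori (f s) xs)"
  by (simp add: cochain_eval_def sum_distrib_left mult_ac)

lemma coboundary_sum:
  "coboundary ori k X (\<lambda>\<sigma>. \<Sum>s\<in>S. c s * f s \<sigma>) \<tau> = (\<Sum>s\<in>S. c s * coboundary ori k X (f s) \<tau>)"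
proof (cases "\<tau> \<in> simplices (k + 1) X")
  case True
  let ?d = "\<lambda>i. take i (ori \<tau>) @ drop (Suc i) (ori \<tau>)"
  have "(\<Sum>i\<le>k + 1. (-1) ^ i * (\<Sum>s\<in>S. c s * cochain_eval ori (f s) (?d i))) =
        (\<Sum>i\<le>k + 1. \<Sum>s\<in>S. c s * ((-1) ^ i * cochain_eval ori (f s) (?d i)))"
    by (simp only: sum_distrib_left mult_ac)
  also have "\<dots> = (\<Sum>s\<in>S. \<Sum>i\<le>k + 1. c s * ((-1) ^ i * cochain_eval ori (f s) (?d i)))"
    by (rule sum.swap)
  also have "\<dots> = (\<Sum>s\<in>S. c s * (\<Sum>i\<le>k + 1. (-1) ^ i * cochain_eval ori (f s) (?d i)))"
    by (simp only: sum_distrib_left)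
  finally show ?thesis
    using True by (simp only: coboundary_def cochain_eval_sum if_True)
qed (simp add: coboundary_def)

lemma cochain_eq_sum:
  assumes "finite X" "\<phi> \<in> cochains k X"
  shows "\<phi> = (\<lambda>\<sigma>. \<Sum>s\<in>simplices k X. \<phi> s * (if \<sigma> = s then 1 else 0))"
proof
  fix \<sigma>
  have "(\<Sum>s\<in>simplices k X. \<phi> s * (if \<sigma> = s then 1 else 0)) =
        (\<Sum>s\<in>simplices k X. if \<sigma> = s then \<phi> s else 0)"
    by (rule sum.cong) auto
  then show "\<phi> \<sigma> = (\<Sum>s\<in>simplices k X. \<phi> s * (if \<sigma> = s then 1 else 0))"
    using assms by (auto simp: cochains_def sum.delta')
qed

lemma coboundary_adjoint_ex1:
  assumes "finite X"
  shows "\<exists>!\<alpha>. \<alpha> \<in> cochains k X \<and> (\<forall>\<phi>\<in>cochains k X.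
     cochain_inner (k + 1) X (coboundary ori k X \<phi>) \<psi> = cochain_inner k X \<phi> \<alpha>)"
proof -
  let ?S = "simplices k X" and ?T = "simplices (k + 1) X"
  let ?e = "\<lambda>s \<sigma>. if \<sigma> = s then 1 else 0 :: real"
  define \<alpha> where "\<alpha> = (\<lambda>s. if s \<in> ?S
    then cochain_inner (k + 1) X (coboundary ori k X (?e s)) \<psi> else 0)"
  have \<alpha>: "\<alpha> \<in> cochains k X"
    by (simp add: \<alpha>_def cochains_def)
  have adj: "cochain_inner (k + 1) X (coboundary ori k X \<phi>) \<psi> = cochain_inner k X \<phi> \<alpha>"
    if \<phi>: "\<phi> \<in> cochains k X" for \<phi>
  proof -
    have "coboundary ori k X \<phi> \<tau> = (\<Sum>s\<in>?S. \<phi> s * coboundary ori k X (?e s) \<tau>)" for \<tau>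
      by (subst cochain_eq_sum[OF assms \<phi>]) (rule coboundary_sum)
    then have "cochain_inner (k + 1) X (coboundary ori k X \<phi>) \<psi> =
        (\<Sum>\<tau>\<in>?T. \<Sum>s\<in>?S. \<phi> s * (coboundary ori k X (?e s) \<tau> * \<psi> \<tau>))"
      by (simp add: cochain_inner_def sum_distrib_right mult.assoc)
    also have "\<dots> = (\<Sum>s\<in>?S. \<Sum>\<tau>\<in>?T. \<phi> s * (coboundary ori k X (?e s) \<tau> * \<psi> \<tau>))"
      by (rule sum.swap)
    also have "\<dots> = cochain_inner k X \<phi> \<alpha>"
      by (simp add: cochain_inner_def \<alpha>_def sum_distrib_left)
    finally show ?thesis .
  qed
  have uniq: "\<alpha>' = \<alpha>"
    if \<alpha>': "\<alpha>' \<in> cochains k X" and adj': "\<And>\<phi>. \<phi> \<in> cochains k X \<Longrightarrow>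
      cochain_inner (k + 1) X (coboundary ori k X \<phi>) \<psi> = cochain_inner k X \<phi> \<alpha>'" for \<alpha>'
  proof
    fix s
    show "\<alpha>' s = \<alpha> s"
    proof (cases "s \<in> ?S")
      case True
      then have "?e s \<in> cochains k X"
        by (auto simp: cochains_def)
      then have "cochain_inner k X (?e s) \<alpha>' = cochain_inner k X (?e s) \<alpha>"
        using adj adj' by metis
      moreover have "cochain_inner k X (?e s) \<gamma> = \<gamma> s" for \<gamma>
      proof -
        have "cochain_inner k X (?e s) \<gamma> = (\<Sum>\<sigma>\<in>?S. if \<sigma> = s then \<gamma> \<sigma> else 0)"
          unfolding cochain_inner_def by (rule sum.cong) auto
        then show ?thesis
          using True assms by (simp add: sum.delta)
      qed
      ultimately show ?thesis by simp
    qed (use \<alpha> \<alpha>' in \<open>simp add: cochains_def\<close>)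
  qed
  show ?thesis
    by (rule ex1I[of _ \<alpha>]) (use \<alpha> adj uniq in blast)+
qed

lemma coboundary_adjoint:
  assumes "finite X"
  shows "coboundary_adjoint ori k X \<psi> \<in> cochains k X"
    and "\<phi> \<in> cochains k X \<Longrightarrow> cochain_inner (k + 1) X (coboundary ori k X \<phi>) \<psi> =
           cochain_inner k X \<phi> (coboundary_adjoint ori k X \<psi>)"
  using theI'[OF coboundary_adjoint_ex1[OF assms], of k ori \<psi>]
  unfolding coboundary_adjoint_def by blast+

end

theory Submission
  imports Defs
begin

text \<open>With \<open>E \<phi> = \<parallel>\<delta>\<phi>\<parallel>\<^sup>2\<close>, adjointness gives
  \<open>E (\<phi> + t\<psi>) = E \<phi> + 2 t \<langle>\<psi>, \<Delta>\<phi>\<rangle> + t\<^sup>2 E \<psi>\<close>. So \<open>\<phi>\<close> minimises \<open>E\<close> among the cochains that agree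
  with it on \<open>K\<close> if and only if \<open>\<Delta>\<phi>\<close> is orthogonal to every cochain \<open>\<psi>\<close> that vanishes on \<open>K\<close>,
  which means that \<open>\<Delta>\<phi>\<close> vanishes off \<open>K\<close>.\<close>

lemma coboundary_add_scaled:
  "coboundary ori k X (\<lambda>\<sigma>. \<phi> \<sigma> + t * \<psi> \<sigma>) =
     (\<lambda>\<tau>. coboundary ori k X \<phi> \<tau> + t * coboundary ori k X \<psi> \<tau>)"
  by (rule ext)
    (simp add: coboundary_def cochain_eval_def sum.distrib sum_distrib_left algebra_simps)

lemma cochain_inner_self_nonneg: "0 \<le> cochain_inner k X \<alpha> \<alpha>"
  by (simp add: cochain_inner_def sum_nonneg)

lemma cochain_inner_add_scaled_self:
  "cochain_inner k X (\<lambda>\<tau>. \<alpha> \<tau> + t * \<gamma> \<tau>) (\<lambda>\<tau>. \<alpha> \<tau> + t * \<gamma> \<tau>) =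
     cochain_inner k X \<alpha> \<alpha> + 2 * t * cochain_inner k X \<gamma> \<alpha> + t\<^sup>2 * cochain_inner k X \<gamma> \<gamma>"
  by (simp add: cochain_inner_def sum_distrib_left sum.distrib[symmetric]
      power2_eq_square algebra_simps)

lemma cochain_norm_le_iff:
  "cochain_norm k X \<alpha> \<le> cochain_norm k X \<gamma> \<longleftrightarrow> cochain_inner k X \<alpha> \<alpha> \<le> cochain_inner k X \<gamma> \<gamma>"
  by (simp add: cochain_norm_def)

lemma coboundary_energy_expand:
  assumes "finite X" "\<psi> \<in> cochains k X"
  shows "cochain_inner (k + 1) X (coboundary ori k X (\<lambda>\<sigma>. \<phi> \<sigma> + t * \<psi> \<sigma>))
           (coboundary ori k X (\<lambda>\<sigma>. \<phi> \<sigma> + t * \<psi> \<sigma>)) =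
         cochain_inner (k + 1) X (coboundary ori k X \<phi>) (coboundary ori k X \<phi>) +
         2 * t * cochain_inner k X \<psi> (up_laplacian ori k X \<phi>) +
         t\<^sup>2 * cochain_inner (k + 1) X (coboundary ori k X \<psi>) (coboundary ori k X \<psi>)"
  using coboundary_adjoint(2)[OF assms]
  by (simp only: coboundary_add_scaled cochain_inner_add_scaled_self up_laplacian_def)

text \<open>The quadratic vanishes at \<open>t = 0\<close>, so nonnegativity makes 0 a minimum, and
  the derivative there is \<open>2 * b\<close>.\<close>

lemma linear_coeff_zero_if_quadratic_nonneg:
  fixes b c :: real
  assumes "0 \<le> c" and nonneg: "\<And>t. 0 \<le> 2 * t * b + t\<^sup>2 * c"
  shows "b = 0"
proof (rule ccontr)
  assume "b \<noteq> 0"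
  \<comment> \<open>The vertex lies at \<open>- b / c\<close>; the denominator \<open>c + 1\<close>
    also covers \<open>c = 0\<close> and still gives the negative value
    \<open>- (u\<^sup>2 * (c + 2))\<close> at \<open>- u\<close>.\<close>
  define u where "u = b / (c + 1)"
  have b: "b = u * (c + 1)"
    using assms(1) by (simp add: u_def)
  have "2 * (- u) * b + (- u)\<^sup>2 * c = - (u\<^sup>2 * (c + 2))"
    by (simp add: b power2_eq_square algebra_simps)
  moreover have "0 < u\<^sup>2 * (c + 2)"
    using assms(1) b \<open>b \<noteq> 0\<close> by (intro mult_pos_pos) auto
  ultimately show False
    using nonneg[of "- u"] by linarith
qed

text \<open>\<open>L - K\<close> is rarely a complex, but \<open>simplices\<close> only filters by
  cardinality.\<close>

lemma simplices_Diff: "simplices k (L - K) = simplices k L - simplices k K"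
  by (auto simp: simplices_def)

text \<open>Restriction extended by zero is an orthogonal projection.\<close>

lemma cochain_inner_restrict_left:
  "cochain_inner k X (cochain_restrict S \<alpha>) \<alpha> =
     cochain_inner k X (cochain_restrict S \<alpha>) (cochain_restrict S \<alpha>)"
  by (auto simp: cochain_inner_def cochain_restrict_def intro!: sum.cong)

text \<open>The inner product sees only the \<open>k\<close>-simplices of \<open>X\<close>;
  elsewhere a cochain is 0 by convention.\<close>

lemma cochain_eq_0_if_inner_self_eq_0:
  assumes "finite X" "\<alpha> \<in> cochains k X" "cochain_inner k X \<alpha> \<alpha> = 0"
  shows "\<alpha> = (\<lambda>_. 0)"
proof
  fix \<sigma>
  have "\<forall>\<sigma>\<in>simplices k X. \<alpha> \<sigma> * \<alpha> \<sigma> = 0"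
    using assms(1,3) by (subst sum_nonneg_eq_0_iff[symmetric]) (auto simp: cochain_inner_def)
  then show "\<alpha> \<sigma> = 0"
    using assms(2) by (auto simp: cochains_def)
qed

theorem proposition4p4:
  fixes K L :: "'v set set" and ori :: "'v set \<Rightarrow> 'v list" and k :: nat
    and \<beta> \<beta>hat :: "'v set \<Rightarrow> real"
  assumes "subcomplex K L"
    and "orientation_on L ori"
    and "\<beta> \<in> cocycles ori k K"
    and "dies_between ori k K L (cohomology_class ori k K \<beta>)"
    and "\<beta>hat \<in> cochains k L"
  shows "death_potential ori k K L \<beta> \<beta>hat \<longleftrightarrow>
      cochain_restrict (simplices k K) \<beta>hat = \<beta> \<and>
      cochain_restrict (simplices k (L - K)) (up_laplacian ori k L \<beta>hat) = (\<lambda>_. 0)"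
proof -
  have fin: "finite L"
    using assms(1) by (simp add: subcomplex_def finite_simplicial_complex_def)
  let ?\<Delta> = "up_laplacian ori k L \<beta>hat"
  \<comment> \<open>This also serves as the test direction: its pairing with
    \<open>?\<Delta>\<close> is its own squared norm.\<close>
  define \<psi> where "\<psi> = cochain_restrict (simplices k (L - K)) ?\<Delta>"
  define E where "E \<phi> = cochain_inner (k + 1) L (coboundary ori k L \<phi>) (coboundary ori k L \<phi>)"
    for \<phi>
  have E_nonneg: "0 \<le> E \<phi>" for \<phi>
    by (simp add: E_def cochain_inner_self_nonneg)
  have E_expand: "E (\<lambda>\<sigma>. \<beta>hat \<sigma> + t * \<phi> \<sigma>) = E \<beta>hat + 2 * t * cochain_inner k L \<phi> ?\<Delta> + t\<^sup>2 * E \<phi>"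
    if "\<phi> \<in> cochains k L" for t \<phi>
    unfolding E_def by (rule coboundary_energy_expand[OF fin that])
  have potential_iff: "death_potential ori k K L \<beta> \<beta>hat \<longleftrightarrow>
      cochain_restrict (simplices k K) \<beta>hat = \<beta> \<and>
      (\<forall>\<phi>\<in>cochains k L. cochain_restrict (simplices k K) \<phi> = \<beta> \<longrightarrow> E \<beta>hat \<le> E \<phi>)"
    using assms(5)
    by (auto simp: death_potential_def is_arg_min_linorder cochain_norm_le_iff E_def)
  have "(\<forall>\<phi>\<in>cochains k L. cochain_restrict (simplices k K) \<phi> = \<beta> \<longrightarrow> E \<beta>hat \<le> E \<phi>) \<longleftrightarrow>
      \<psi> = (\<lambda>_. 0)" if restr: "cochain_restrict (simplices k K) \<beta>hat = \<beta>"
  proof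
    assume min: "\<forall>\<phi>\<in>cochains k L. cochain_restrict (simplices k K) \<phi> = \<beta> \<longrightarrow> E \<beta>hat \<le> E \<phi>"
    have \<psi>: "\<psi> \<in> cochains k L"
      by (auto simp: \<psi>_def cochain_restrict_def cochains_def simplices_Diff)
    \<comment> \<open>Since \<psi> vanishes on \<open>K\<close>, moving along it by any
      \<open>t\<close>, of either sign, stays among the extensions of \<beta>.\<close>
    have "0 \<le> 2 * t * cochain_inner k L \<psi> ?\<Delta> + t\<^sup>2 * E \<psi>" for t
    proof -
      have "(\<lambda>\<sigma>. \<beta>hat \<sigma> + t * \<psi> \<sigma>) \<in> cochains k L"
        using \<psi> assms(5) by (simp add: cochains_def)
      moreover have "cochain_restrict (simplices k K) (\<lambda>\<sigma>. \<beta>hat \<sigma> + t * \<psi> \<sigma>) = \<beta>"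
        unfolding restr[symmetric] by (auto simp: \<psi>_def cochain_restrict_def simplices_Diff)
      ultimately show ?thesis
        using min E_expand[OF \<psi>, of t] by fastforce
    qed
    then have "cochain_inner k L \<psi> ?\<Delta> = 0"
      by (rule linear_coeff_zero_if_quadratic_nonneg[OF E_nonneg])
    then show "\<psi> = (\<lambda>_. 0)"
      using cochain_eq_0_if_inner_self_eq_0[OF fin \<psi>]
      by (simp add: \<psi>_def cochain_inner_restrict_left)
  next
    assume \<psi>0: "\<psi> = (\<lambda>_. 0)"
    show "\<forall>\<phi>\<in>cochains k L. cochain_restrict (simplices k K) \<phi> = \<beta> \<longrightarrow> E \<beta>hat \<le> E \<phi>"
    proof (intro ballI impI)
      fix \<phi>
      assume \<phi>: "\<phi> \<in> cochains k L" and "cochain_restrict (simplices k K) \<phi> = \<beta>"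
      then have eq: "cochain_restrict (simplices k K) \<phi> \<sigma> =
          cochain_restrict (simplices k K) \<beta>hat \<sigma>" for \<sigma>
        by (simp add: restr)
      let ?d = "\<lambda>\<sigma>. \<phi> \<sigma> - \<beta>hat \<sigma>"
      have d: "?d \<in> cochains k L"
        using \<phi> assms(5) by (simp add: cochains_def)
      \<comment> \<open>The supports are disjoint: \<open>?d\<close> vanishes on \<open>K\<close>
        because both cochains extend \<beta>, and \<open>?\<Delta>\<close> vanishes off
        \<open>K\<close> by \<open>\<psi>0\<close>.\<close>
      have "?d \<sigma> * ?\<Delta> \<sigma> = 0" if "\<sigma> \<in> simplices k L" for \<sigma>
        using that eq[of \<sigma>] fun_cong[OF \<psi>0, of \<sigma>]
        by (auto simp: \<psi>_def cochain_restrict_def simplices_Diff split: if_splits)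
      then have "cochain_inner k L ?d ?\<Delta> = 0"
        unfolding cochain_inner_def by (intro sum.neutral) blast
      \<comment> \<open>At \<open>t = 1\<close> the expansion reaches \<phi>; with no linear term,
        the energy grows by exactly \<open>E ?d\<close>.\<close>
      then show "E \<beta>hat \<le> E \<phi>"
        using E_expand[OF d, of 1] E_nonneg[of ?d] by simp
    qed
  qed
  then show ?thesis
    unfolding potential_iff \<psi>_def by blast
qed

end
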